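(* Let $I=\langle\mathcal{A},\emptyset,\mathcal{R},\mathcal{R}^?\rangle$ be an AtIAF and $S\subseteq\mathcal{A}$ a set of arguments such that $S$ is not stable-$\mathtt{st}$ w.r.t. $I$. For each attack $r=(a,b)\in\mathcal{R}^?$ such that $a\notin S$ or $b\notin S$: - $r\in RE^+(I,S,\mathtt{st}\text{-}true)$ iff $a\in S$ and $b\notin S_I^+$; and - $r\notin RE^-(I,S,\mathtt{st}\text{-}true)$.
   Context: An argumentation framework (AF) is a pair $F=\langle \mathcal{A}_F,\mathcal{R}_F\rangle$ with $\mathcal{R}_F\subseteq\mathcal{A}_F\times\mathcal{A}_F$; $a$ attacks $b$ if $(a,b)\in\mathcal{R}_F$. For $S\subseteq\mathcal{A}_F$, $S_F^+$ is the set of arguments attacked by some element of $S$; $S$ is conflict-free iff $S\cap S_F^+=\emptyset$; $S\in\mathtt{st}(F)$ (stable semantics) iff $S$ is conflict-free and $S_F^+=\mathcal{A}_F\setminus S$. $S$ is $\mathtt{st}$-$true$ in $F$ iff $S\in\mathtt{st}(F)$. An incomplete argumentation framework (IAF) is $I=\langle\mathcal{A},\mathcal{A}^?,\mathcal{R},\mathcal{R}^?\rangle$ with $\mathcal{A},\mathcal{A}^?$ disjoint sets of (certain, uncertain) arguments and $\mathcal{R},\mathcal{R}^?$ disjoint subsets of $(\mathcal{A}\cup\mathcal{A}^?)\times(\mathcal{A}\cup\mathcal{A}^?)$ (certain, uncertain attacks). An AtIAF is an IAF with $\mathcal{A}^?=\emptyset$. A partial completion of $I$ is an IAF $I'=\langle\mathcal{A}',\mathcal{A}^{?'},\mathcal{R}',\mathcal{R}^{?'}\rangle$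 with $\mathcal{A}\subseteq\mathcal{A}'\subseteq\mathcal{A}\cup\mathcal{A}^?$, $\mathcal{R}\cap((\mathcal{A}'\cup\mathcal{A}^{?'})\times(\mathcal{A}'\cup\mathcal{A}^{?'}))\subseteq\mathcal{R}'\subseteq\mathcal{R}\cup\mathcal{R}^?$, $\mathcal{A}^{?'}\subseteq\mathcal{A}^?$, $\mathcal{R}^{?'}\subseteq\mathcal{R}^?$; $part(I)$ is the set of partial completions. $cert(I)=\langle\mathcal{A},\mathcal{R}\cap(\mathcal{A}\times\mathcal{A})\rangle$. A completion of $I$ is an AF of the form $cert(I')$ with $I'\in part(I)$ (for an AtIAF: an AF $\langle\mathcal{A},\mathcal{R}_F\rangle$ with $\mathcal{R}\subseteq\mathcal{R}_F\subseteq\mathcal{R}\cup\mathcal{R}^?$). For $\mathcal{R}_0\subseteq\mathcal{R}^?$: $I+\mathcal{R}_0=\langle\mathcal{A},\mathcal{A}^?,\mathcal{R}\cup\mathcal{R}_0,\mathcal{R}^?\setminus\mathcal{R}_0\rangle$ and $I-\mathcal{R}_0=\langle\mathcal{A},\mathcal{A}^?,\mathcal{R},\mathcal{R}^?\setminus\mathcal{R}_0\rangle$. For $S\subseteq\mathcal{A}\cup\mathcal{A}^?$: $S_I^+=\{a\in\mathcal{A}\cup\mathcal{A}^?\mid\exists b\in S,(b,a)\in\mathcal{R}\}$. $S$ is stable-$\mathtt{st}$ w.r.t. $I$ iff either $S\in\mathtt{st}(F)$ for every completion $F$ of $I$, or $S\notin\mathtt{st}(F)$ for every completion $F$ of $I$.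 Relevance: for $e\in\mathcal{R}^?$, $e\in RE^+(I,S,\mathtt{st}\text{-}true)$ (resp. $e\in RE^-(I,S,\mathtt{st}\text{-}true)$) iff there is $I'=\langle\mathcal{A}',\mathcal{A}^{?'},\mathcal{R}',\mathcal{R}^{?'}\rangle\in part(I)$ with $\mathcal{A}^{?'}\cup\mathcal{R}^{?'}=\{e\}$ such that $S$ is $\mathtt{st}$-$true$ in $cert(I'+\{e\})$ (resp. $cert(I'-\{e\})$) and $S$ is not $\mathtt{st}$-$true$ in $cert(I'-\{e\})$ (resp. $cert(I'+\{e\})$). *)

theory Defs imports Main begin

record 'a af =
  args :: "'a set"
  atts :: "('a \<times> 'a) set"

definition is_af :: "'a af \<Rightarrow> bool" where
  "is_af F \<longleftrightarrow> atts F \<subseteq> args F \<times> args F"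

definition af_attacked :: "'a af \<Rightarrow> 'a set \<Rightarrow> 'a set" where
  "af_attacked F S = {b \<in> args F. \<exists>a\<in>S. (a, b) \<in> atts F}"

definition conflict_free :: "'a af \<Rightarrow> 'a set \<Rightarrow> bool" where
  "conflict_free F S \<longleftrightarrow> S \<inter> af_attacked F S = {}"

definition st :: "'a af \<Rightarrow> 'a set set" where
  "st F = {S. S \<subseteq> args F \<and> conflict_free F S \<and> af_attacked F S = args F - S}"

definition st_true :: "'a set \<Rightarrow> 'a af \<Rightarrow> bool" where
  "st_true S F \<longleftrightarrow> S \<in> st F"

record 'a iaf =
  cert_args :: "'a set"
  unc_args :: "'a set"
  cert_atts :: "('a \<times> 'a) set"
  unc_atts :: "('a \<times> 'a) set"

definition is_iaf :: "'a iaf \<Rightarrow> bool" where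
  "is_iaf I \<longleftrightarrow>
     cert_args I \<inter> unc_args I = {} \<and>
     cert_atts I \<inter> unc_atts I = {} \<and>
     cert_atts I \<subseteq> (cert_args I \<union> unc_args I) \<times> (cert_args I \<union> unc_args I) \<and>
     unc_atts I \<subseteq> (cert_args I \<union> unc_args I) \<times> (cert_args I \<union> unc_args I)"

definition is_atiaf :: "'a iaf \<Rightarrow> bool" where
  "is_atiaf I \<longleftrightarrow> is_iaf I \<and> unc_args I = {}"

definition part :: "'a iaf \<Rightarrow> 'a iaf set" where
  "part I = {I'. is_iaf I' \<and>
     cert_args I \<subseteq> cert_args I' \<and> cert_args I' \<subseteq> cert_args I \<union> unc_args I \<and>
     cert_atts I \<inter> ((cert_args I' \<union> unc_args I') \<times> (cert_args I' \<union> unc_args I')) \<subseteq> cert_atts I' \<and>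
     cert_atts I' \<subseteq> cert_atts I \<union> unc_atts I \<and>
     unc_args I' \<subseteq> unc_args I \<and>
     unc_atts I' \<subseteq> unc_atts I}"

definition cert :: "'a iaf \<Rightarrow> 'a af" where
  "cert I = \<lparr>args = cert_args I, atts = cert_atts I \<inter> (cert_args I \<times> cert_args I)\<rparr>"

definition completions :: "'a iaf \<Rightarrow> 'a af set" where
  "completions I = cert ` part I"

lemma is_af_completion: "F \<in> completions I \<Longrightarrow> is_af F"
  by (auto simp: completions_def cert_def is_af_def)

lemma completions_atiaf:
  fixes I :: "'a iaf"
  assumes "is_atiaf I"
  shows "completions I =
    {F. args F = cert_args I \<and> cert_atts I \<subseteq> atts F \<and> atts F \<subseteq> cert_atts I \<union> unc_atts I}"
proof (intro equalityI subsetI)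
  fix F :: "'a af" assume "F \<in> completions I"
  then show "F \<in> {F. args F = cert_args I \<and> cert_atts I \<subseteq> atts F \<and>
      atts F \<subseteq> cert_atts I \<union> unc_atts I}"
    using assms
    by (auto simp: completions_def part_def cert_def is_atiaf_def is_iaf_def) blast+
next
  fix F :: "'a af" assume F: "F \<in> {F. args F = cert_args I \<and> cert_atts I \<subseteq> atts F \<and>
      atts F \<subseteq> cert_atts I \<union> unc_atts I}"
  let ?J = "\<lparr>cert_args = cert_args I, unc_args = {}, cert_atts = atts F, unc_atts = {}\<rparr>"
  have sub: "atts F \<subseteq> cert_args I \<times> cert_args I"
    using F assms unfolding is_atiaf_def is_iaf_def by blast
  then have "?J \<in> part I"
    using F by (auto simp: part_def is_iaf_def)
  moreover have "F = cert ?J"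
    using F sub by (auto simp: cert_def intro!: af.equality)
  ultimately show "F \<in> completions I"
    unfolding completions_def by blast
qed

definition add_atts :: "'a iaf \<Rightarrow> ('a \<times> 'a) set \<Rightarrow> 'a iaf" where
  "add_atts I R0 = I\<lparr>cert_atts := cert_atts I \<union> R0, unc_atts := unc_atts I - R0\<rparr>"

definition del_atts :: "'a iaf \<Rightarrow> ('a \<times> 'a) set \<Rightarrow> 'a iaf" where
  "del_atts I R0 = I\<lparr>unc_atts := unc_atts I - R0\<rparr>"

definition iaf_attacked :: "'a iaf \<Rightarrow> 'a set \<Rightarrow> 'a set" where
  "iaf_attacked I S = {a \<in> cert_args I \<union> unc_args I. \<exists>b\<in>S. (b, a) \<in> cert_atts I}"

definition stable_st :: "'a iaf \<Rightarrow> 'a set \<Rightarrow> bool" where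
  "stable_st I S \<longleftrightarrow>
     (\<forall>F\<in>completions I. S \<in> st F) \<or> (\<forall>F\<in>completions I. S \<notin> st F)"

(* Arguments and attacks have different types, so the set of all uncertain
   elements of an IAF is a disjoint sum, in which the attack e is Inr e. *)
definition RE_pos ::
    "'a iaf \<Rightarrow> 'a set \<Rightarrow> ('a set \<Rightarrow> 'a af \<Rightarrow> bool) \<Rightarrow> ('a \<times> 'a) set" where
  "RE_pos I S P = {e \<in> unc_atts I. \<exists>I'\<in>part I. unc_args I' <+> unc_atts I' = {Inr e} \<and>
     P S (cert (add_atts I' {e})) \<and> \<not> P S (cert (del_atts I' {e}))}"

definition RE_neg ::
    "'a iaf \<Rightarrow> 'a set \<Rightarrow> ('a set \<Rightarrow> 'a af \<Rightarrow> bool) \<Rightarrow> ('a \<times> 'a) set" where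
  "RE_neg I S P = {e \<in> unc_atts I. \<exists>I'\<in>part I. unc_args I' <+> unc_atts I' = {Inr e} \<and>
     P S (cert (del_atts I' {e})) \<and> \<not> P S (cert (add_atts I' {e}))}"

end

(* Whether S is stable depends only on the set of arguments attacked by S, so an attack (a, b)
   matters only if a is in S and nothing else in S attacks b; it then helps if b is outside S.
   Conversely, if S is stable in a completion F, dropping from F all attacks from S on b makes
   (a, b) decisive; this is allowed when b is not attacked by S with certainty. *)
theory Submission imports Defs begin

text \<open>Conflict-freeness and attacking the whole complement merge into one pointwise condition.
  The restriction of attacks in \<open>cert\<close> disappears because both ends lie in
  \<open>cert_args J\<close>.\<close>

lemma mem_st_cert_iff:
  assumes "S \<subseteq> cert_args J"
  shows "S \<in> st (cert J) \<longleftrightarrow>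
    (\<forall>x\<in>cert_args J. x \<in> S \<longleftrightarrow> \<not> (\<exists>s\<in>S. (s, x) \<in> cert_atts J))"
  using assms
  unfolding st_def conflict_free_def af_attacked_def cert_def af.simps mem_Collect_eq set_eq_iff by blast

lemma cert_args_add_atts [simp]: "cert_args (add_atts J R) = cert_args J"
  and cert_atts_add_atts [simp]: "cert_atts (add_atts J R) = cert_atts J \<union> R"
  by (simp_all add: add_atts_def)

text \<open>Only \<open>unc_atts\<close> changes, and \<open>cert\<close> ignores it. So relevance
  compares \<open>cert J\<close> itself with the completion that gains the attack.\<close>

lemma cert_del_atts [simp]: "cert (del_atts J R) = cert J"
  by (simp add: del_atts_def cert_def)

lemma mem_st_add_atts_redundant:
  assumes "S \<subseteq> cert_args J"
    and "a \<notin> S \<or> (\<exists>s\<in>S. (s, b) \<in> cert_atts J)"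
  shows "S \<in> st (cert (add_atts J {(a, b)})) \<longleftrightarrow> S \<in> st (cert J)"
proof -
  have "(\<exists>s\<in>S. (s, x) \<in> cert_atts J \<union> {(a, b)}) \<longleftrightarrow> (\<exists>s\<in>S. (s, x) \<in> cert_atts J)" for x
    using assms(2) by blast
  then show ?thesis
    using assms(1) by (simp only: mem_st_cert_iff cert_args_add_atts cert_atts_add_atts)
qed

lemma cert_args_part_atiaf:
  assumes "is_atiaf I" "J \<in> part I"
  shows "cert_args J = cert_args I"
  using assms by (auto simp: is_atiaf_def part_def)

text \<open>With no uncertain arguments, no endpoint of a certain attack can be lost, so the
  restriction in \<open>part\<close> removes nothing.\<close>

lemma cert_atts_part_atiaf:
  assumes "is_atiaf I" "J \<in> part I"
  shows "cert_atts I \<subseteq> cert_atts J"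
proof -
  have "cert_atts I \<subseteq> cert_args I \<times> cert_args I"
    using assms(1) by (auto simp: is_atiaf_def is_iaf_def)
  moreover have "cert_args I \<subseteq> cert_args J"
    and "cert_atts I \<inter> (cert_args J \<union> unc_args J) \<times> (cert_args J \<union> unc_args J) \<subseteq> cert_atts J"
    using assms(2) by (simp_all add: part_def)
  ultimately show ?thesis by blast
qed

lemma RE_pos_st_if_completion:
  assumes I: "is_atiaf I" and S: "S \<subseteq> cert_args I"
    and F: "F \<in> completions I" "S \<in> st F"
    and e: "(a, b) \<in> unc_atts I"
    and a: "a \<in> S" and b: "b \<notin> S" "b \<notin> iaf_attacked I S"
  shows "(a, b) \<in> RE_pos I S st_true"
proof -
  obtain G where G: "G \<in> part I" "S \<in> st (cert G)"
    using F by (auto simp: completions_def)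
  note args_G = cert_args_part_atiaf[OF I G(1)]
  have b_args: "b \<in> cert_args I"
    using I e by (auto simp: is_atiaf_def is_iaf_def)
  \<comment> \<open>In \<open>J\<close>, nothing in \<open>S\<close> attacks \<open>b\<close>, so
    \<open>S\<close> fails there. Adding \<open>(a, b)\<close> restores the attack on
    \<open>b\<close>, and every other argument is attacked by \<open>S\<close> exactly as in
    \<open>G\<close>.\<close>
  define J where "J = \<lparr>cert_args = cert_args I, unc_args = {},
    cert_atts = cert_atts G - S \<times> {b}, unc_atts = {(a, b)}\<rparr>"
  \<comment> \<open>No certain attack of \<open>I\<close> is dropped, so \<open>J\<close> can be a
    partial completion.\<close>
  have not_cert: "cert_atts I \<inter> S \<times> {b} = {}"
    using b(2) b_args by (auto simp: iaf_attacked_def)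
  have "cert_atts G \<subseteq> cert_args I \<times> cert_args I"
    using G(1) I unfolding part_def is_atiaf_def is_iaf_def by auto
  \<comment> \<open>As \<open>a\<close> is in \<open>S\<close>, \<open>(a, b)\<close> is among the
    removed attacks, so certain and uncertain attacks are disjoint.\<close>
  then have "is_iaf J"
    using a S b_args by (auto simp: J_def is_iaf_def)
  then have J: "J \<in> part I"
    using G(1) e not_cert cert_atts_part_atiaf[OF I G(1)]
    unfolding part_def J_def by auto
  have stG: "\<forall>x\<in>cert_args I. x \<in> S \<longleftrightarrow> \<not> (\<exists>s\<in>S. (s, x) \<in> cert_atts G)"
    using G(2) S by (simp add: mem_st_cert_iff args_G)
  have "S \<in> st (cert (add_atts J {(a, b)}))"
    using stG S a b(1) by (subst mem_st_cert_iff) (auto simp: J_def)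
  moreover have "S \<notin> st (cert J)"
    using S b(1) b_args by (subst mem_st_cert_iff) (auto simp: J_def)
  moreover have "unc_args J <+> unc_atts J = {Inr (a, b)}"
    by (auto simp: J_def)
  ultimately show ?thesis
    using e J by (auto simp: RE_pos_def st_true_def)
qed

theorem proposition4:
  fixes I :: "'a iaf" and S :: "'a set"
  assumes "is_atiaf I"
    and "S \<subseteq> cert_args I"
    and "\<not> stable_st I S"
  shows "\<forall>a b. (a, b) \<in> unc_atts I \<and> (a \<notin> S \<or> b \<notin> S) \<longrightarrow>
    ((a, b) \<in> RE_pos I S st_true \<longleftrightarrow> a \<in> S \<and> b \<notin> iaf_attacked I S) \<and>
    (a, b) \<notin> RE_neg I S st_true"
proof (intro allI impI, elim conjE)
  fix a b assume e: "(a, b) \<in> unc_atts I" and ab: "a \<notin> S \<or> b \<notin> S"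
  have redundant: "S \<in> st (cert (add_atts J {(a, b)})) \<longleftrightarrow> S \<in> st (cert J)"
    if "J \<in> part I" "a \<notin> S \<or> (\<exists>s\<in>S. (s, b) \<in> cert_atts J)" for J
    using that assms(1,2) by (simp add: mem_st_add_atts_redundant cert_args_part_atiaf)
  \<comment> \<open>Contraposition: a certain attack from \<open>S\<close> on \<open>b\<close>
    survives in every partial completion and makes \<open>(a, b)\<close> redundant there.\<close>
  have "a \<in> S \<and> b \<notin> iaf_attacked I S" if "(a, b) \<in> RE_pos I S st_true"
    using that redundant cert_atts_part_atiaf[OF assms(1)]
    unfolding RE_pos_def st_true_def iaf_attacked_def cert_del_atts by blast
  moreover obtain F where "F \<in> completions I" "S \<in> st F"
    using assms(3) by (auto simp: stable_st_def)
  then have "(a, b) \<in> RE_pos I S st_true" if "a \<in> S \<and> b \<notin> iaf_attacked I S"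
    using RE_pos_st_if_completion[OF assms(1,2)] e ab that by blast
  moreover have "(a, b) \<notin> RE_neg I S st_true"
  proof
    assume "(a, b) \<in> RE_neg I S st_true"
    then obtain J where J: "J \<in> part I" "S \<in> st (cert J)"
        "S \<notin> st (cert (add_atts J {(a, b)}))"
      by (auto simp: RE_neg_def st_true_def)
    have "b \<in> cert_args I"
      using assms(1) e by (auto simp: is_atiaf_def is_iaf_def)
    \<comment> \<open>If \<open>b\<close> is outside \<open>S\<close>, stability in
      \<open>cert J\<close> means that \<open>S\<close> already attacks \<open>b\<close>; otherwise
      \<open>ab\<close> gives \<open>a \<notin> S\<close>. Either way \<open>(a, b)\<close> is
      redundant.\<close>
    then have "b \<notin> S \<longrightarrow> (\<exists>s\<in>S. (s, b) \<in> cert_atts J)"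
      using J(2) assms(2) cert_args_part_atiaf[OF assms(1) J(1)]
      by (simp add: mem_st_cert_iff)
    then show False
      using redundant[OF J(1)] J(2,3) ab by blast
  qed
  ultimately show "((a, b) \<in> RE_pos I S st_true \<longleftrightarrow> a \<in> S \<and> b \<notin> iaf_attacked I S) \<and>
    (a, b) \<notin> RE_neg I S st_true"
    by blast
qed

end
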